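(* Let $n\ge 1$, let $\alpha\in(-\frac1n,0]$, and let $f,g,h\in C_\alpha(\mathbb{R}^n)$. Then $$\|f\|_1\,\|g\star_\alpha h\|_1\le\frac{4^n}{\prod_{j=1}^n(1+j\alpha)^2}\,\|f\star_\alpha g\|_1\,\|f\star_\alpha h\|_1 .$$
   Context: For $\alpha\in(-\infty,0]$, a function $f:\mathbb{R}^n\to[0,\infty)$ is $\alpha$-concave if for all $x,y$ with $f(x),f(y)>0$ and all $\lambda\in[0,1]$, $f(\lambda x+(1-\lambda)y)\ge[\lambda f(x)^\alpha+(1-\lambda)f(y)^\alpha]^{1/\alpha}$, where the right side is read as $f(x)^\lambda f(y)^{1-\lambda}$ for $\alpha=0$. $C_\alpha(\mathbb{R}^n)$ is the set of upper semicontinuous $\alpha$-concave $f:\mathbb{R}^n\to[0,\infty)$ with $\|f\|_\infty=f(0)=1$ and $\lim_{|x|\to\infty}f(x)=0$. The $\alpha$-sum is $(f\star_\alpha g)(x)=\sup_{y+z=x}(f(y)^\alpha+g(z)^\alpha-1)^{1/\alpha}$ for $-\infty<\alpha<0$ (the expression is $0$ whenever $f(y)=0$ or $g(z)=0$), and $(f\star_0 g)(x)=\sup_{y+z=x}f(y)g(z)$. $\|f\|_1=\int_{\mathbb{R}^n}f(x)\,dx$ for $f\ge0$. *)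

theory Defs
  imports "HOL-Analysis.Analysis"
begin

definition usc :: "('a::topological_space \<Rightarrow> real) \<Rightarrow> bool" where
  "usc f \<longleftrightarrow> (\<forall>x. \<forall>c > f x. \<forall>\<^sub>F y in nhds x. f y < c)"

(* Only used for a, b > 0, where powr is the ordinary real power. *)
definition alpha_mean :: "real \<Rightarrow> real \<Rightarrow> real \<Rightarrow> real \<Rightarrow> real" where
  "alpha_mean \<alpha> t a b =
     (if \<alpha> = 0 then a powr t * b powr (1 - t)
      else (t * a powr \<alpha> + (1 - t) * b powr \<alpha>) powr (1 / \<alpha>))"

definition alpha_concave :: "real \<Rightarrow> (real ^ 'n \<Rightarrow> real) \<Rightarrow> bool" where
  "alpha_concave \<alpha> f \<longleftrightarrow>
     (\<forall>x. 0 \<le> f x) \<and>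
     (\<forall>x y. \<forall>t\<in>{0..1}. 0 < f x \<longrightarrow> 0 < f y \<longrightarrow>
        alpha_mean \<alpha> t (f x) (f y) \<le> f (t *\<^sub>R x + (1 - t) *\<^sub>R y))"

(* The pointwise supremum, not the essential one; ereal-valued, so that an
   unbounded f has norm infinity. *)
definition sup_norm :: "(real ^ 'n \<Rightarrow> real) \<Rightarrow> ereal" where
  "sup_norm f = (SUP x. ereal \<bar>f x\<bar>)"

definition C_alpha :: "real \<Rightarrow> (real ^ 'n \<Rightarrow> real) set" where
  "C_alpha \<alpha> = {f. usc f \<and> alpha_concave \<alpha> f \<and>
     sup_norm f = ereal (f 0) \<and> f 0 = 1 \<and> (f \<longlongrightarrow> 0) at_infinity}"

(* The explicit case is needed because 0 powr \<alpha> = 0 in HOL, also for \<alpha> < 0,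
   where the intended value is infinity. *)
definition alpha_term :: "real \<Rightarrow> real \<Rightarrow> real \<Rightarrow> real" where
  "alpha_term \<alpha> a b =
     (if \<alpha> = 0 then a * b
      else if a = 0 \<or> b = 0 then 0
      else (a powr \<alpha> + b powr \<alpha> - 1) powr (1 / \<alpha>))"

(* A supremum of reals; it is over a bounded set on C_alpha, see
   alpha_sum_bdd_above below. *)
definition alpha_sum ::
    "real \<Rightarrow> (real ^ 'n \<Rightarrow> real) \<Rightarrow> (real ^ 'n \<Rightarrow> real) \<Rightarrow> real ^ 'n \<Rightarrow> real" where
  "alpha_sum \<alpha> f g x = Sup {alpha_term \<alpha> (f y) (g z) | y z. y + z = x}"

(* For f \<ge> 0. *)
definition L1_norm :: "(real ^ 'n \<Rightarrow> real) \<Rightarrow> ennreal" where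
  "L1_norm f = (\<integral>\<^sup>+ x. ennreal (f x) \<partial>lborel)"

lemma C_alpha_bounds:
  assumes "f \<in> C_alpha \<alpha>"
  shows "0 \<le> f x" and "f x \<le> 1"
proof -
  show "0 \<le> f x"
    using assms by (simp add: C_alpha_def alpha_concave_def)
  have "ereal \<bar>f x\<bar> \<le> sup_norm f"
    unfolding sup_norm_def by (rule SUP_upper) simp
  also have "sup_norm f = ereal 1"
    using assms by (simp add: C_alpha_def)
  finally show "f x \<le> 1" by simp
qed

lemma alpha_term_bounds:
  assumes "\<alpha> \<le> 0" "0 \<le> a" "a \<le> 1" "0 \<le> b" "b \<le> 1"
  shows "0 \<le> alpha_term \<alpha> a b" and "alpha_term \<alpha> a b \<le> 1"
proof -
  show "0 \<le> alpha_term \<alpha> a b"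
    using assms by (simp add: alpha_term_def)
  have *: "1 \<le> c powr \<alpha>" if "0 < c" "c \<le> 1" for c :: real
    using powr_mono2'[of \<alpha> c 1] assms(1) that by simp
  show "alpha_term \<alpha> a b \<le> 1"
  proof (cases "\<alpha> = 0 \<or> a = 0 \<or> b = 0")
    case True
    then show ?thesis
      using assms by (auto simp: alpha_term_def mult_le_one)
  next
    case False
    then have "1 \<le> a powr \<alpha> + b powr \<alpha> - 1"
      using *[of a] *[of b] assms by simp
    then have "(a powr \<alpha> + b powr \<alpha> - 1) powr (1 / \<alpha>) \<le> 1 powr (1 / \<alpha>)"
      using assms(1) by (intro powr_mono2') auto
    then show ?thesis
      using False by (simp add: alpha_term_def)
  qed
qed

lemma alpha_sum_bdd_above:
  assumes "\<alpha> \<le> 0" "f \<in> C_alpha \<alpha>" "g \<in> C_alpha \<alpha>"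
  shows "bdd_above {alpha_term \<alpha> (f y) (g z) | y z. y + z = x}"
  using alpha_term_bounds(2)[OF assms(1)] C_alpha_bounds[OF assms(2)] C_alpha_bounds[OF assms(3)]
  by (intro bdd_aboveI[of _ 1]) auto

end

theory Submission
  imports Defs "HOL-Real_Asymp.Real_Asymp"
begin

text \<open>
  The inequality is proved for log-concave functions with the constant \<open>4 ^ n\<close> and then transferred
  to negative \<open>\<alpha>\<close>, each of the two integrals on the left costing a factor
  \<open>1 / (\<Prod>j = 1..n. 1 + j * \<alpha>)\<close>.

  Log-concave case (\<open>log_concave_case\<close>). Write \<open>G * H\<close> for the sum with parameter 0. For a fixed
  vector \<open>m\<close>, a maximizing decomposition \<open>s = b + d\<close> and a free \<open>w\<close>, the points \<open>w + b\<close> and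
  \<open>(m - w) + d\<close> have the sum \<open>m + s\<close>, and the product of \<open>F * G\<close> at the first and \<open>F * H\<close> at the second
  is at least \<open>F w * F (m - w) * (G * H) s\<close>. Integration over \<open>w\<close> and \<open>s\<close> bounds the product of the
  norms of \<open>F * G\<close> and \<open>F * H\<close> from below by the norm of \<open>G * H\<close> times the self-convolution of \<open>F\<close> at
  \<open>m\<close> (\<open>product_ge_convolution\<close>). The supremum of that self-convolution over \<open>m\<close> is at least
  \<open>4 ^ (-n)\<close> times the integral of \<open>F\<close>, by log-concavity and \<open>F 0 = 1\<close>
  (\<open>integral_le_of_convolution_le\<close>).

  Transfer to \<open>\<alpha> < 0\<close>. An \<open>\<alpha>\<close>-concave function has the form \<open>(1 + \<phi>) powr (1 / \<alpha>)\<close> with \<open>\<phi>\<close> convex, nonnegative,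
  possibly infinite and 0 at the origin. Replacing it by \<open>exp (\<phi> / \<alpha>)\<close> gives a log-concave function
  (\<open>logify_in_C_alpha_0\<close>), and this replacement is compatible with the sums
  (\<open>alpha_sum_eq_unlogify\<close>), since both are infimal convolutions of the functions \<open>\<phi>\<close>. It decreases
  integrals (\<open>le_unlogify\<close>), which is used on the right-hand side, and it decreases them by no more
  than the factor above (\<open>unlogify_integral_le\<close>), which is used on the left-hand side.
\<close>

section \<open>Affine substitution and attained suprema\<close>

lemma nn_integral_lborel_affine:
  fixes F :: "'a::euclidean_space \<Rightarrow> ennreal" and c :: real
  assumes [measurable]: "F \<in> borel_measurable borel" and "c \<noteq> 0"
  shows "(\<integral>\<^sup>+ x. F x \<partial>lborel) = ennreal (\<bar>c\<bar> ^ DIM('a)) * (\<integral>\<^sup>+ x. F (t + c *\<^sub>R x) \<partial>lborel)"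
  by (subst lborel_affine[OF \<open>c \<noteq> 0\<close>, of t])
    (simp add: nn_integral_density nn_integral_distr nn_integral_cmult)

text \<open>
  A maximizer over \<open>X\<close> is a common point of the sets \<open>{p. Q i \<le> Q p}\<close> inside
  \<open>{p \<in> X. Q x0 \<le> Q p}\<close>, for \<open>i\<close> in the latter set; these form a chain of nonempty compact sets.
\<close>

lemma attains_max_of_compact_superlevels:
  fixes Q :: "'a::t2_space \<Rightarrow> real"
  assumes cpt: "\<And>c. c > 0 \<Longrightarrow> compact {p. c \<le> Q p}" and "closed X" and "x0 \<in> X" "0 < Q x0"
  shows "\<exists>x\<in>X. \<forall>y\<in>X. Q y \<le> Q x"
proof -
  \<comment> \<open>Starting at the height of \<open>x0\<close> makes the set compact and keeps all later levels positive.\<close>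
  define I where "I = {p \<in> X. Q x0 \<le> Q p}"
  have "I \<inter> (\<Inter>i\<in>I. {p. Q i \<le> Q p}) \<noteq> {}"
  proof (rule compact_imp_fip_image)
    have "I = X \<inter> {p. Q x0 \<le> Q p}"
      by (auto simp: I_def)
    then show "compact I"
      using closed_Int_compact[OF \<open>closed X\<close> cpt[OF \<open>0 < Q x0\<close>]] by simp
  next
    fix i assume "i \<in> I"
    then show "closed {p. Q i \<le> Q p}"
      using \<open>0 < Q x0\<close> by (intro compact_imp_closed cpt) (auto simp: I_def)
  next
    fix J assume J: "finite J" "J \<subseteq> I"
    show "I \<inter> (\<Inter>i\<in>J. {p. Q i \<le> Q p}) \<noteq> {}"
    proof (cases "J = {}")
      case True
      then show ?thesis
        using \<open>x0 \<in> X\<close> by (auto simp: I_def)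
    next
      case False
      then have "Max (Q ` J) \<in> Q ` J"
        using J by (intro Max_in) auto
      then obtain m where "m \<in> J" "Q m = Max (Q ` J)" by force
      then have "m \<in> I \<inter> (\<Inter>i\<in>J. {p. Q i \<le> Q p})"
        using J by auto
      then show ?thesis by blast
    qed
  qed
  then obtain x where x: "x \<in> I" "\<And>i. i \<in> I \<Longrightarrow> Q i \<le> Q x" by blast
  have "Q y \<le> Q x" if "y \<in> X" for y
    using x(2)[of y] x(1) that by (cases "Q x0 \<le> Q y") (auto simp: I_def)
  then show ?thesis
    using x(1) by (auto simp: I_def)
qed

section \<open>Compact superlevels and log-concavity\<close>

text \<open>
  Closedness of the superlevels is upper semicontinuity and their boundedness is decay at infinity.
  This form of the class is easy to transport along an increasing change of values, along products
  and along images under addition, which is all that happens to these functions below.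
\<close>

lemma C_alpha_iff_compact_superlevels:
  fixes f :: "real ^ 'n \<Rightarrow> real"
  shows "f \<in> C_alpha \<alpha> \<longleftrightarrow>
    alpha_concave \<alpha> f \<and> f 0 = 1 \<and> (\<forall>x. f x \<le> 1) \<and> (\<forall>c>0. compact {x. c \<le> f x})"
proof
  assume f: "f \<in> C_alpha \<alpha>"
  have "compact {x. c \<le> f x}" if "c > 0" for c
  proof -
    have "open {x. f x < c}"
      using f unfolding C_alpha_def usc_def eventually_nhds
      by (subst open_subopen) (simp add: subset_iff, blast)
    moreover have "{x. c \<le> f x} = - {x. f x < c}" by auto
    ultimately have "closed {x. c \<le> f x}" by (simp add: closed_def)
    moreover have "bounded {x. c \<le> f x}"
    proof -
      have "(f \<longlongrightarrow> 0) at_infinity"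
        using f by (simp add: C_alpha_def)
      then have "\<forall>\<^sub>F x in at_infinity. f x < c"
        using that by (rule order_tendstoD)
      then obtain b where "\<And>x. b \<le> norm x \<Longrightarrow> f x < c"
        by (auto simp: eventually_at_infinity)
      then show ?thesis
        by (intro boundedI[of _ b]) (meson linorder_not_le mem_Collect_eq nle_le)
    qed
    ultimately show ?thesis by (simp add: compact_eq_bounded_closed)
  qed
  then show "alpha_concave \<alpha> f \<and> f 0 = 1 \<and> (\<forall>x. f x \<le> 1) \<and> (\<forall>c>0. compact {x. c \<le> f x})"
    using f C_alpha_bounds[OF f] by (auto simp: C_alpha_def)
next
  assume f: "alpha_concave \<alpha> f \<and> f 0 = 1 \<and> (\<forall>x. f x \<le> 1) \<and> (\<forall>c>0. compact {x. c \<le> f x})"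
  then have nonneg: "0 \<le> f x" for x
    by (simp add: alpha_concave_def)
  have "usc f"
    unfolding usc_def
  proof (intro allI impI)
    fix x c assume "f x < c"
    then have "c > 0" using nonneg[of x] by simp
    then have "closed {y. c \<le> f y}"
      using f compact_imp_closed by blast
    moreover have "- {y. c \<le> f y} = {y. f y < c}" by auto
    ultimately have "open {y. f y < c}" by (simp add: closed_def)
    then show "\<forall>\<^sub>F y in nhds x. f y < c"
      using \<open>f x < c\<close> by (auto simp: eventually_nhds)
  qed
  moreover have "sup_norm f = ereal (f 0)"
    unfolding sup_norm_def using f nonneg by (intro antisym SUP_least SUP_upper2[of 0]) auto
  moreover have "(f \<longlongrightarrow> 0) at_infinity"
  proof (rule order_tendstoI)
    fix c :: real assume "c < 0"
    then show "\<forall>\<^sub>F x in at_infinity. c < f x"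
      using nonneg by (auto intro!: always_eventually intro: less_le_trans)
  next
    fix c :: real assume "0 < c"
    then have "bounded {x. c \<le> f x}"
      using f compact_imp_bounded by blast
    then obtain b where "\<And>x. c \<le> f x \<Longrightarrow> norm x \<le> b"
      by (auto simp: bounded_iff)
    then show "\<forall>\<^sub>F x in at_infinity. f x < c"
      unfolding eventually_at_infinity by (intro exI[of _ "b + 1"]) (smt (verit))
  qed
  ultimately show "f \<in> C_alpha \<alpha>"
    using f by (simp add: C_alpha_def)
qed

lemma borel_measurable_C_alpha:
  fixes f :: "real ^ 'n \<Rightarrow> real"
  assumes "f \<in> C_alpha \<alpha>"
  shows "f \<in> borel_measurable borel"
proof (rule borel_measurableI_ge)
  fix c :: real
  show "{x \<in> space borel. c \<le> f x} \<in> sets borel"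
  proof (cases "c > 0")
    case True
    then have "compact {x. c \<le> f x}"
      using assms by (simp add: C_alpha_iff_compact_superlevels)
    then show ?thesis by (simp add: borel_compact)
  next
    case False
    then have "{x. c \<le> f x} = UNIV"
      using C_alpha_bounds(1)[OF assms] by (auto intro: order_trans[of _ 0])
    then show ?thesis by simp
  qed
qed

lemma log_concaveI:
  assumes "\<And>x. 0 \<le> f x" and "\<And>x y t. 0 \<le> t \<Longrightarrow> t \<le> 1 \<Longrightarrow> 0 < f x \<Longrightarrow> 0 < f y \<Longrightarrow>
    f x powr t * f y powr (1 - t) \<le> f (t *\<^sub>R x + (1 - t) *\<^sub>R y)"
  shows "alpha_concave 0 f"
  using assms by (auto simp: alpha_concave_def alpha_mean_def)

text \<open>
  Since \<open>0 powr t = 0\<close>, also for \<open>t = 0\<close>, the inequality of log-concavity holds for all pairs of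
  points and not only on the support.
\<close>

lemma log_concaveD:
  assumes "alpha_concave 0 f" "0 \<le> t" "t \<le> 1"
  shows "f x powr t * f y powr (1 - t) \<le> f (t *\<^sub>R x + (1 - t) *\<^sub>R y)"
proof (cases "f x = 0 \<or> f y = 0")
  case True
  then show ?thesis using assms by (auto simp: alpha_concave_def)
next
  case False
  then have "0 < f x" "0 < f y"
    using assms(1) by (auto simp: alpha_concave_def less_le)
  then show ?thesis
    using assms by (auto simp: alpha_concave_def alpha_mean_def)
qed

section \<open>The sum of log-concave functions\<close>

text \<open>
  Closedness is the point: for values in \<open>[0, 1]\<close>, a product \<open>a * b\<close> is at least \<open>c\<close> exactly when
  every \<open>r > 0\<close> satisfies \<open>r \<le> a\<close> or \<open>c / r \<le> b\<close>, which writes the superlevel of the product as an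
  intersection of unions of closed cylinders.
\<close>

lemma compact_product_superlevels:
  fixes G :: "'a::metric_space \<Rightarrow> real" and H :: "'b::metric_space \<Rightarrow> real"
  assumes G: "\<And>c. c > 0 \<Longrightarrow> compact {x. c \<le> G x}" "\<And>x. 0 \<le> G x" "\<And>x. G x \<le> 1"
    and H: "\<And>c. c > 0 \<Longrightarrow> compact {x. c \<le> H x}" "\<And>x. 0 \<le> H x" "\<And>x. H x \<le> 1"
    and "c > 0"
  shows "compact {p. c \<le> G (fst p) * H (snd p)}" (is "compact ?A")
proof -
  have prod_ge_iff: "c \<le> a * b \<longleftrightarrow> (\<forall>r>0. r \<le> a \<or> c / r \<le> b)"
    if ab: "0 \<le> a" "0 \<le> b" "b \<le> 1" for a b
  proof
    assume c: "c \<le> a * b"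
    show "\<forall>r>0. r \<le> a \<or> c / r \<le> b"
    proof (intro allI impI)
      fix r :: real assume "r > 0"
      have "c \<le> b * r" if "a < r"
        using c mult_right_mono[of a r b] that ab by (simp add: mult.commute)
      then show "r \<le> a \<or> c / r \<le> b"
        using \<open>r > 0\<close> by (cases "r \<le> a") (auto simp: field_simps)
    qed
  next
    assume *: "\<forall>r>0. r \<le> a \<or> c / r \<le> b"
    show "c \<le> a * b"
    proof (rule ccontr)
      assume lt: "\<not> c \<le> a * b"
      show False
      proof (cases "b = 0")
        case True
        \<comment> \<open>Any \<open>r\<close> above \<open>a\<close> works, since then \<open>c / r > 0 = b\<close>.\<close>
        then show False using *[rule_format, of "a + 1"] ab \<open>c > 0\<close> by (auto simp: field_simps)
      next
        case False
        then have "a < c / b" using lt ab by (simp add: field_simps)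
        then obtain r where r: "a < r" "r < c / b" using dense by blast
        then have "r > 0" using ab by simp
        then have "b < c / r" using r ab False by (simp add: field_simps)
        then show False using *[rule_format, OF \<open>r > 0\<close>] r by simp
      qed
    qed
  qed
  have "?A = (\<Inter>r\<in>{0<..}. {x. r \<le> G x} \<times> UNIV \<union> UNIV \<times> {x. c / r \<le> H x})"
    using prod_ge_iff G H by auto
  moreover have "closed \<dots>"
    using G(1) H(1) \<open>c > 0\<close>
    by (intro closed_INT ballI closed_Un closed_Times) (auto intro: compact_imp_closed)
  ultimately have "closed ?A" by simp
  moreover have "?A \<subseteq> {x. c \<le> G x} \<times> {x. c \<le> H x}"
  proof clarsimp
    fix x y assume "c \<le> G x * H y"
    moreover have "G x * H y \<le> G x" "G x * H y \<le> H y"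
      using G H by (auto simp: mult_left_le mult_left_le_one_le)
    ultimately show "c \<le> G x \<and> c \<le> H y" by linarith
  qed
  moreover have "compact ({x. c \<le> G x} \<times> {x. c \<le> H x})"
    using G H \<open>c > 0\<close> by (intro compact_Times) auto
  ultimately show ?thesis
    using closed_Int_compact[of ?A "{x. c \<le> G x} \<times> {x. c \<le> H x}"] by (simp add: Int_absorb2)
qed

lemma log_sum_attained:
  fixes G H :: "real ^ 'n \<Rightarrow> real"
  assumes G: "G \<in> C_alpha \<alpha>" and H: "H \<in> C_alpha \<beta>"
  obtains y z where "y + z = x" and "\<And>y' z'. y' + z' = x \<Longrightarrow> G y' * H z' \<le> G y * H z"
proof (cases "\<exists>y z. y + z = x \<and> 0 < G y * H z")
  case True
  then obtain y0 z0 where yz0: "y0 + z0 = x" "0 < G y0 * H z0" by blast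
  define X where "X = {p. fst p + snd p = x}"
  define Q where "Q = (\<lambda>p. G (fst p) * H (snd p))"
  have "closed X"
    unfolding X_def by (intro closed_Collect_eq continuous_intros)
  moreover have "compact {p. c \<le> Q p}" if "c > 0" for c
    unfolding Q_def using that G H C_alpha_bounds[OF G] C_alpha_bounds[OF H]
    by (intro compact_product_superlevels) (auto simp: C_alpha_iff_compact_superlevels)
  ultimately have "\<exists>p\<in>X. \<forall>q\<in>X. Q q \<le> Q p"
    using yz0 by (intro attains_max_of_compact_superlevels[where ?x0.0 = "(y0, z0)"])
      (auto simp: X_def Q_def)
  then obtain p where p: "p \<in> X" "\<forall>q\<in>X. Q q \<le> Q p" by blast
  show ?thesis
    by (rule that[of "fst p" "snd p"]) (use p in \<open>auto simp: X_def Q_def\<close>)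
next
  case False
  show ?thesis
  proof (rule that[of x 0])
    fix y z assume "y + z = x"
    then have "G y * H z \<le> 0" using False by (metis linorder_not_le)
    then show "G y * H z \<le> G x * H 0"
      using C_alpha_bounds(1)[OF G, of x] C_alpha_bounds(1)[OF H, of 0]
      by (meson mult_nonneg_nonneg order_trans)
  qed simp
qed

lemma log_sum_eqI:
  assumes "y + z = x" and "\<And>y' z'. y' + z' = x \<Longrightarrow> G y' * H z' \<le> G y * H z"
  shows "alpha_sum 0 G H x = G y * H z"
  unfolding alpha_sum_def alpha_term_def using assms by (intro cSup_eq_maximum) auto

lemma log_sum_upper:
  fixes G H :: "real ^ 'n \<Rightarrow> real"
  assumes G: "G \<in> C_alpha 0" and H: "H \<in> C_alpha 0"
  shows "G y * H z \<le> alpha_sum 0 G H (y + z)"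
proof -
  have "alpha_term 0 (G y) (H z) \<le> alpha_sum 0 G H (y + z)"
    unfolding alpha_sum_def by (intro cSup_upper alpha_sum_bdd_above[OF _ G H]) auto
  then show ?thesis by (simp add: alpha_term_def)
qed

text \<open>
  Since the supremum is attained, a superlevel of the sum is the image of a superlevel of
  \<open>G y * H z\<close> under addition, hence compact; in particular the sum is measurable. Log-concavity
  follows by combining maximizing decompositions of two points.
\<close>

lemma alpha_sum_0_in_C_alpha:
  fixes G H :: "real ^ 'n \<Rightarrow> real"
  assumes G: "G \<in> C_alpha 0" and H: "H \<in> C_alpha 0"
  shows "alpha_sum 0 G H \<in> C_alpha 0"
proof -
  note G01 = C_alpha_bounds[OF G] and H01 = C_alpha_bounds[OF H]
  let ?K = "alpha_sum 0 G H"
  have attained: "\<exists>y z. y + z = x \<and> ?K x = G y * H z" for x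
    using log_sum_attained[OF G H, of x] log_sum_eqI[of _ _ x G H] by metis
  have K01: "0 \<le> ?K x" "?K x \<le> 1" for x
    using attained[of x] G01 H01 by (auto, simp add: mult_le_one)
  have "?K 0 = 1"
    using log_sum_upper[OF G H, of 0 0] K01(2)[of 0] G H by (simp add: C_alpha_def)
  moreover have "compact {x. c \<le> ?K x}" if "c > 0" for c
  proof -
    let ?A = "{p. c \<le> G (fst p) * H (snd p)}"
    have "{x. c \<le> ?K x} = (\<lambda>p. fst p + snd p) ` ?A"
    proof safe
      fix x assume "c \<le> ?K x"
      then show "x \<in> (\<lambda>p. fst p + snd p) ` ?A"
        using attained[of x] by (force simp: image_iff)
    next
      fix y z assume "c \<le> G (fst (y, z)) * H (snd (y, z))"
      then show "c \<le> ?K (fst (y, z) + snd (y, z))"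
        using log_sum_upper[OF G H, of y z] by simp
    qed
    moreover have "compact ?A"
      using that G H G01 H01
      by (intro compact_product_superlevels) (auto simp: C_alpha_iff_compact_superlevels)
    moreover have "continuous_on ?A (\<lambda>p. fst p + snd p)"
      by (intro continuous_intros)
    ultimately show ?thesis
      using compact_continuous_image by simp
  qed
  moreover have "alpha_concave 0 ?K"
  proof (rule log_concaveI[OF K01(1)])
    fix x x' and t :: real assume t: "0 \<le> t" "t \<le> 1"
    obtain y z where yz: "y + z = x" "?K x = G y * H z"
      using attained by blast
    obtain y' z' where yz': "y' + z' = x'" "?K x' = G y' * H z'"
      using attained by blast
    have "?K x powr t * ?K x' powr (1 - t) =
        (G y powr t * G y' powr (1 - t)) * (H z powr t * H z' powr (1 - t))"
      using G01 H01 by (simp add: yz yz' powr_mult)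
    also have "\<dots> \<le> G (t *\<^sub>R y + (1 - t) *\<^sub>R y') * H (t *\<^sub>R z + (1 - t) *\<^sub>R z')"
      using G H G01 t by (intro mult_mono log_concaveD) (auto simp: C_alpha_def)
    also have "\<dots> \<le> ?K ((t *\<^sub>R y + (1 - t) *\<^sub>R y') + (t *\<^sub>R z + (1 - t) *\<^sub>R z'))"
      by (rule log_sum_upper[OF G H])
    also have "(t *\<^sub>R y + (1 - t) *\<^sub>R y') + (t *\<^sub>R z + (1 - t) *\<^sub>R z') = t *\<^sub>R x + (1 - t) *\<^sub>R x'"
      by (simp flip: yz(1) yz'(1) add: algebra_simps)
    finally show "?K x powr t * ?K x' powr (1 - t) \<le> ?K (t *\<^sub>R x + (1 - t) *\<^sub>R x')" .
  qed
  ultimately show ?thesis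
    using K01 by (simp add: C_alpha_iff_compact_superlevels)
qed

section \<open>The inequality for log-concave functions\<close>

text \<open>
  Midpoint log-concavity is used twice: \<open>F w\<close> and \<open>F (m - w)\<close> have geometric mean at most
  \<open>F (m / 2)\<close>, and, compared with the value 1 at the origin, \<open>sqrt (F w) \<le> F (w / 2)\<close>.
\<close>

lemma log_convolution_le:
  fixes F :: "real ^ 'n \<Rightarrow> real"
  assumes bnd: "\<And>x. 0 \<le> F x" and "F 0 = 1"
    and mid: "\<And>x y. sqrt (F x * F y) \<le> F ((1/2) *\<^sub>R (x + y))"
  shows "F w * F (m - w) \<le> F ((1/2) *\<^sub>R m) * (F ((1/2) *\<^sub>R w) * F ((1/2) *\<^sub>R (m - w)))"
proof -
  have half: "sqrt (F x) \<le> F ((1/2) *\<^sub>R x)" for x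
    using mid[of x 0] \<open>F 0 = 1\<close> by simp
  have "F w * F (m - w) = sqrt (F w * F (m - w)) * (sqrt (F w) * sqrt (F (m - w)))"
    using bnd[of w] bnd[of "m - w"]
    by (simp only: real_sqrt_mult[symmetric] real_sqrt_mult_self) simp
  also have "\<dots> \<le> F ((1/2) *\<^sub>R m) * (F ((1/2) *\<^sub>R w) * F ((1/2) *\<^sub>R (m - w)))"
    using mid[of w "m - w"] half[of w] half[of "m - w"] bnd by (intro mult_mono) auto
  finally show ?thesis .
qed

text \<open>
  A log-concave \<open>F\<close> with value 1 at the origin has a self-convolution whose supremum is at least
  \<open>4 ^ (-n)\<close> times its integral. Integrate the pointwise bound over \<open>w\<close> and \<open>m\<close>: each of the two
  halvings costs a factor \<open>2 ^ n\<close>, and one factor \<open>\<integral> F\<close> cancels. The supremum is expressed through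
  the constants \<open>H\<close> and \<open>P\<close>, which avoids dividing in the extended nonnegative reals.
\<close>

lemma integral_le_of_convolution_le:
  fixes F :: "real ^ 'n \<Rightarrow> real" and P H :: ennreal
  assumes [measurable]: "F \<in> borel_measurable borel"
    and bnd: "\<And>x. 0 \<le> F x" and "F 0 = 1"
    and mid: "\<And>x y. sqrt (F x * F y) \<le> F ((1/2) *\<^sub>R (x + y))"
    and fin: "(\<integral>\<^sup>+ x. ennreal (F x) \<partial>lborel) < \<infinity>"
    and conv: "\<And>m. H * (\<integral>\<^sup>+ w. ennreal (F w * F (m - w)) \<partial>lborel) \<le> P"
  shows "H * (\<integral>\<^sup>+ x. ennreal (F x) \<partial>lborel) \<le> ennreal (4 ^ CARD('n)) * P"
proof -
  define I where "I = (\<integral>\<^sup>+ x. ennreal (F x) \<partial>lborel)"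
  define D where "D = ennreal (2 ^ CARD('n))"
  define c where "c = (\<lambda>m. \<integral>\<^sup>+ w. ennreal (F w * F (m - w)) \<partial>lborel)"
  have [measurable]: "c \<in> borel_measurable borel"
    unfolding c_def by measurable
  have DD: "D * D = ennreal (4 ^ CARD('n))"
    unfolding D_def by (simp flip: ennreal_mult power_mult_distrib)
  have half: "(\<integral>\<^sup>+ x. G ((1/2) *\<^sub>R x) \<partial>lborel) = D * (\<integral>\<^sup>+ x. G x \<partial>lborel)"
    if [measurable]: "G \<in> borel_measurable borel" for G :: "real ^ 'n \<Rightarrow> ennreal"
    using nn_integral_lborel_affine[of "\<lambda>x. G ((1/2) *\<^sub>R x)" 2 0] by (simp add: D_def)
  have "I * I = (\<integral>\<^sup>+ w. \<integral>\<^sup>+ m. ennreal (F w) * ennreal (F (m - w)) \<partial>lborel \<partial>lborel)"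
  proof -
    have "(\<integral>\<^sup>+ m. ennreal (F (m - w)) \<partial>lborel) = I" for w
      using nn_integral_lborel_affine[of "\<lambda>m. ennreal (F (m - w))" 1 w] by (simp add: I_def)
    then show ?thesis
      by (simp add: nn_integral_cmult nn_integral_multc I_def[symmetric])
  qed
  also have "\<dots> = (\<integral>\<^sup>+ m. c m \<partial>lborel)"
    unfolding c_def by (subst lborel_pair.Fubini') (auto simp: bnd ennreal_mult)
  also have "\<dots> \<le> (\<integral>\<^sup>+ m. ennreal (F ((1/2) *\<^sub>R m)) * (D * c ((1/2) *\<^sub>R m)) \<partial>lborel)"
  proof (rule nn_integral_mono)
    fix m :: "real ^ 'n"
    have "c m \<le> (\<integral>\<^sup>+ w. ennreal (F ((1/2) *\<^sub>R m)) *
        ennreal (F ((1/2) *\<^sub>R w) * F ((1/2) *\<^sub>R m - (1/2) *\<^sub>R w)) \<partial>lborel)"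
      unfolding c_def using log_convolution_le[of F, OF bnd \<open>F 0 = 1\<close> mid, of _ m] bnd
      by (intro nn_integral_mono) (simp add: ennreal_mult[symmetric] scaleR_diff_right ennreal_leI)
    also have "\<dots> = ennreal (F ((1/2) *\<^sub>R m)) * (D * c ((1/2) *\<^sub>R m))"
      unfolding c_def
      by (subst half[of "\<lambda>w. ennreal (F w * F ((1/2) *\<^sub>R m - w))", symmetric])
        (simp_all add: nn_integral_cmult)
    finally show "c m \<le> ennreal (F ((1/2) *\<^sub>R m)) * (D * c ((1/2) *\<^sub>R m))" .
  qed
  also have "\<dots> = D * (\<integral>\<^sup>+ m. ennreal (F m) * (D * c m) \<partial>lborel)"
    by (subst half[symmetric]) simp_all
  finally have "H * (I * I) \<le> H * (D * (\<integral>\<^sup>+ m. ennreal (F m) * (D * c m) \<partial>lborel))"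
    by (intro mult_left_mono) auto
  also have "\<dots> = D * D * (\<integral>\<^sup>+ m. ennreal (F m) * (H * c m) \<partial>lborel)"
    by (simp flip: nn_integral_cmult add: mult_ac)
  also have "\<dots> \<le> D * D * (\<integral>\<^sup>+ m. ennreal (F m) * P \<partial>lborel)"
    using conv by (intro mult_left_mono nn_integral_mono) (auto simp: c_def)
  also have "\<dots> = D * D * P * I"
    by (subst nn_integral_multc) (simp_all add: I_def mult_ac)
  finally have *: "I * (H * I) \<le> I * (D * D * P)"
    by (simp add: mult_ac)
  show ?thesis
  proof (cases "I = 0")
    case True
    then show ?thesis by (simp add: I_def)
  next
    case False
    then show ?thesis
      using * fin unfolding I_def[symmetric] DD[symmetric]
      by (subst (asm) ennreal_mult_le_mult_iff) (auto simp: mult_ac)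
  qed
qed

text \<open>
  A volume-preserving change of variables in the spirit of Ruzsa's triangle inequality. If
  \<open>s = b + d\<close> is a maximizing decomposition for the sum of \<open>G\<close> and \<open>H\<close>, then for every \<open>w\<close> the points \<open>w + b\<close> and \<open>(m - w) + d\<close>
  have the fixed sum \<open>m + s\<close>, and the sums with \<open>F\<close> are there at least \<open>F w * G b\<close> and
  \<open>F (m - w) * H d\<close>. Integrating over \<open>w\<close> and \<open>s\<close> gives the claim, because
  \<open>(u, s) \<mapsto> (u, m + s - u)\<close> preserves Lebesgue measure.
\<close>

lemma product_ge_convolution:
  fixes F G H :: "real ^ 'n \<Rightarrow> real"
  assumes F: "F \<in> C_alpha 0" and G: "G \<in> C_alpha 0" and H: "H \<in> C_alpha 0"
  shows "L1_norm (alpha_sum 0 G H) * (\<integral>\<^sup>+ w. ennreal (F w * F (m - w)) \<partial>lborel)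
    \<le> L1_norm (alpha_sum 0 F G) * L1_norm (alpha_sum 0 F H)"
proof -
  let ?FG = "alpha_sum 0 F G" and ?FH = "alpha_sum 0 F H" and ?GH = "alpha_sum 0 G H"
  note C = alpha_sum_0_in_C_alpha[OF F G] alpha_sum_0_in_C_alpha[OF F H] alpha_sum_0_in_C_alpha[OF G H]
  note [measurable] = C[THEN borel_measurable_C_alpha] F[THEN borel_measurable_C_alpha]
  note nonneg = F[THEN C_alpha_bounds(1)] G[THEN C_alpha_bounds(1)] H[THEN C_alpha_bounds(1)]
    C[THEN C_alpha_bounds(1)]
  define c where "c = (\<integral>\<^sup>+ w. ennreal (F w * F (m - w)) \<partial>lborel)"
  have shift: "(\<integral>\<^sup>+ x. K (t + x) \<partial>lborel) = (\<integral>\<^sup>+ x. K x \<partial>lborel)"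
    if "K \<in> borel_measurable borel" for K :: "real ^ 'n \<Rightarrow> ennreal" and t
    using nn_integral_lborel_affine[OF that, of 1 t] by simp
  have "L1_norm ?GH * c = (\<integral>\<^sup>+ s. ennreal (?GH s) * c \<partial>lborel)"
    by (simp add: nn_integral_multc L1_norm_def)
  also have "\<dots> \<le> (\<integral>\<^sup>+ s. \<integral>\<^sup>+ u. ennreal (?FG u * ?FH (m + s - u)) \<partial>lborel \<partial>lborel)"
  proof (rule nn_integral_mono)
    fix s :: "real ^ 'n"
    obtain b d where bd: "b + d = s" "?GH s = G b * H d"
      using log_sum_attained[OF G H, of s] log_sum_eqI[of _ _ s G H] by metis
    have "ennreal (?GH s) * c = (\<integral>\<^sup>+ w. ennreal (?GH s * (F w * F (m - w))) \<partial>lborel)"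
      unfolding c_def using nonneg by (simp add: ennreal_mult nn_integral_cmult)
    also have "\<dots> \<le> (\<integral>\<^sup>+ w. ennreal (?FG (b + w) * ?FH (m + s - (b + w))) \<partial>lborel)"
    proof (intro nn_integral_mono ennreal_leI)
      fix w
      have "?GH s * (F w * F (m - w)) = (F w * G b) * (F (m - w) * H d)"
        by (simp add: bd)
      also have "\<dots> \<le> ?FG (w + b) * ?FH ((m - w) + d)"
        using nonneg by (intro mult_mono log_sum_upper F G H) auto
      also have "(m - w) + d = m + s - (b + w)"
        by (simp flip: bd(1))
      finally show "?GH s * (F w * F (m - w)) \<le> ?FG (b + w) * ?FH (m + s - (b + w))"
        by (simp add: add.commute)
    qed
    also have "\<dots> = (\<integral>\<^sup>+ u. ennreal (?FG u * ?FH (m + s - u)) \<partial>lborel)"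
      by (rule shift[of "\<lambda>u. ennreal (?FG u * ?FH (m + s - u))"]) simp
    finally show "ennreal (?GH s) * c \<le> (\<integral>\<^sup>+ u. ennreal (?FG u * ?FH (m + s - u)) \<partial>lborel)" .
  qed
  also have "\<dots> = (\<integral>\<^sup>+ u. \<integral>\<^sup>+ s. ennreal (?FG u * ?FH (m + s - u)) \<partial>lborel \<partial>lborel)"
    by (rule lborel_pair.Fubini') simp
  also have "\<dots> = (\<integral>\<^sup>+ u. ennreal (?FG u) * L1_norm ?FH \<partial>lborel)"
  proof (rule nn_integral_cong)
    fix u :: "real ^ 'n"
    have "(\<integral>\<^sup>+ s. ennreal (?FG u * ?FH (m + s - u)) \<partial>lborel) =
        (\<integral>\<^sup>+ s. ennreal (?FG u) * ennreal (?FH ((m - u) + s)) \<partial>lborel)"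
      using nonneg by (simp add: ennreal_mult algebra_simps)
    also have "\<dots> = ennreal (?FG u) * L1_norm ?FH"
      unfolding L1_norm_def by (subst shift[symmetric, of _ "m - u"]) (simp_all add: nn_integral_cmult)
    finally show "(\<integral>\<^sup>+ s. ennreal (?FG u * ?FH (m + s - u)) \<partial>lborel) = ennreal (?FG u) * L1_norm ?FH" .
  qed
  also have "\<dots> = L1_norm ?FG * L1_norm ?FH"
    by (simp add: nn_integral_multc L1_norm_def)
  finally show ?thesis by (simp add: c_def)
qed

text \<open>
  Truncating \<open>F\<close> to balls keeps it log-concave and makes its integral finite, as needed for the
  cancellation in \<open>integral_le_of_convolution_le\<close>; the full integral is then a monotone limit.
\<close>

lemma log_concave_case:
  fixes F G H :: "real ^ 'n \<Rightarrow> real"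
  assumes F: "F \<in> C_alpha 0" and G: "G \<in> C_alpha 0" and H: "H \<in> C_alpha 0"
  shows "L1_norm F * L1_norm (alpha_sum 0 G H)
    \<le> ennreal (4 ^ CARD('n)) * (L1_norm (alpha_sum 0 F G) * L1_norm (alpha_sum 0 F H))"
    (is "_ * ?H \<le> _ * ?P")
proof -
  note [measurable] = F[THEN borel_measurable_C_alpha]
  note F01 = C_alpha_bounds[OF F]
  define FR where "FR = (\<lambda>(R :: nat) x. F x * indicator (cball 0 R) x)"
  have FR_meas[measurable]: "FR R \<in> borel_measurable borel" for R
    unfolding FR_def by (intro borel_measurable_times borel_measurable_indicator) auto
  have trunc: "?H * (\<integral>\<^sup>+ x. ennreal (FR R x) \<partial>lborel) \<le> ennreal (4 ^ CARD('n)) * ?P" for R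
  proof (rule integral_le_of_convolution_le)
    show "FR R 0 = 1"
      using F by (simp add: FR_def C_alpha_def)
    show "sqrt (FR R x * FR R y) \<le> FR R ((1/2) *\<^sub>R (x + y))" for x y
    proof (cases "x \<in> cball 0 R \<and> y \<in> cball 0 R")
      case True
      then have "(1/2) *\<^sub>R x + (1/2) *\<^sub>R y \<in> cball 0 R"
        by (intro convexD[OF convex_cball]) auto
      moreover have "sqrt (F x * F y) = F x powr (1/2) * F y powr (1/2)"
        using F01 by (simp add: real_sqrt_mult powr_half_sqrt)
      ultimately show ?thesis
        using True F log_concaveD[of F "1/2" x y] by (simp add: FR_def C_alpha_def scaleR_add_right)
    next
      case False
      then show ?thesis using F01 by (auto simp: FR_def indicator_def)
    qed
    have "(\<integral>\<^sup>+ x. ennreal (FR R x) \<partial>lborel) \<le> (\<integral>\<^sup>+ x. indicator (cball 0 (real R)) x \<partial>(lborel :: (real ^ 'n) measure))"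
      using F01 by (intro nn_integral_mono) (auto simp: FR_def indicator_def)
    also have "\<dots> < \<infinity>"
      using emeasure_lborel_cball_finite by simp
    finally show "(\<integral>\<^sup>+ x. ennreal (FR R x) \<partial>lborel) < \<infinity>" .
    fix m
    have "?H * (\<integral>\<^sup>+ w. ennreal (FR R w * FR R (m - w)) \<partial>lborel) \<le>
        ?H * (\<integral>\<^sup>+ w. ennreal (F w * F (m - w)) \<partial>lborel)"
      using F01 by (intro mult_left_mono nn_integral_mono) (auto simp: FR_def indicator_def)
    also have "\<dots> \<le> ?P"
      by (rule product_ge_convolution[OF F G H])
    finally show "?H * (\<integral>\<^sup>+ w. ennreal (FR R w * FR R (m - w)) \<partial>lborel) \<le> ?P" .
  qed (use F01 in \<open>auto simp: FR_def[abs_def] intro: FR_meas[unfolded FR_def]\<close>)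
  have "L1_norm F = (\<integral>\<^sup>+ x. (SUP R. ennreal (FR R x)) \<partial>lborel)"
    unfolding L1_norm_def
  proof (intro nn_integral_cong antisym SUP_least)
    fix x :: "real ^ 'n"
    obtain R :: nat where "norm x \<le> real R"
      using real_arch_simple by blast
    then show "ennreal (F x) \<le> (SUP R. ennreal (FR R x))"
      by (intro SUP_upper2[of R]) (auto simp: FR_def)
  next
    fix x R show "ennreal (FR R x) \<le> ennreal (F x)"
      using F01 by (auto simp: FR_def indicator_def)
  qed
  also have "\<dots> = (SUP R. \<integral>\<^sup>+ x. ennreal (FR R x) \<partial>lborel)"
    using F01 by (intro nn_integral_monotone_convergence_SUP)
      (auto simp: incseq_def le_fun_def FR_def indicator_def)
  finally have "?H * L1_norm F = (SUP R. ?H * (\<integral>\<^sup>+ x. ennreal (FR R x) \<partial>lborel))"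
    by (simp add: SUP_mult_left_ennreal)
  also have "\<dots> \<le> ennreal (4 ^ CARD('n)) * ?P"
    using trunc by (intro SUP_least) auto
  finally show ?thesis by (simp add: mult_ac)
qed

section \<open>Layer cake, moments and the crossing argument\<close>

text \<open>
  Layer cake formula in the height variable \<open>u = - ln (K x)\<close>: a decreasing function of that height
  is integrated by weighting the superlevels of \<open>K\<close> with minus its derivative.
\<close>

lemma nn_integral_layer_cake:
  fixes K :: "real ^ 'n \<Rightarrow> real" and e w :: "real \<Rightarrow> real"
  assumes [measurable]: "K \<in> borel_measurable borel" "w \<in> borel_measurable borel"
    and K: "\<And>x. 0 \<le> K x" "\<And>x. K x \<le> 1"
    and deriv: "\<And>u. 0 \<le> u \<Longrightarrow> (e has_real_derivative - w u) (at u)"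
    and w: "\<And>u. 0 \<le> u \<Longrightarrow> 0 \<le> w u" and lim: "(e \<longlongrightarrow> 0) at_top"
  shows "(\<integral>\<^sup>+ x. ennreal (if K x = 0 then 0 else e (- ln (K x))) \<partial>lborel)
    = (\<integral>\<^sup>+ u. ennreal (w u) * indicator {0..} u * emeasure lborel {x. exp (- u) \<le> K x} \<partial>lborel)"
proof -
  let ?L = "\<lambda>u x. indicator {0..} (K x - exp (- u)) :: ennreal"
  have "(\<integral>\<^sup>+ x. ennreal (if K x = 0 then 0 else e (- ln (K x))) \<partial>lborel) =
      (\<integral>\<^sup>+ x. \<integral>\<^sup>+ u. ennreal (w u) * indicator {0..} u * ?L u x \<partial>lborel \<partial>lborel)"
  proof (rule nn_integral_cong)
    fix x
    show "ennreal (if K x = 0 then 0 else e (- ln (K x))) =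
        (\<integral>\<^sup>+ u. ennreal (w u) * indicator {0..} u * ?L u x \<partial>lborel)"
    proof (cases "K x = 0")
      case False
      then have pos: "0 < K x" using K(1)[of x] by simp
      then have ln: "0 \<le> - ln (K x)" using K(2)[of x] by simp
      have "(\<integral>\<^sup>+ u. ennreal (w u) * indicator {- ln (K x)..} u \<partial>lborel) = ennreal (0 - (- e (- ln (K x))))"
      proof (rule nn_integral_FTC_atLeast)
        fix u assume "- ln (K x) \<le> u"
        then have "0 \<le> u" using ln by simp
        then show "((\<lambda>u. - e u) has_real_derivative w u) (at u)" "0 \<le> w u"
          using DERIV_minus[OF deriv] w by auto
      qed (use tendsto_minus[OF lim] in simp_all)
      moreover have "indicator {0..} u * ?L u x = indicator {- ln (K x)..} u" for u
      proof -
        have "exp (- u) \<le> K x \<longleftrightarrow> - ln (K x) \<le> u"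
          using ln_ge_iff[OF pos, of "- u"] by linarith
        then show ?thesis using ln by (auto simp: indicator_def)
      qed
      ultimately show ?thesis
        using False by (simp add: mult.assoc)
    qed (simp add: indicator_def not_le)
  qed
  also have "\<dots> = (\<integral>\<^sup>+ u. \<integral>\<^sup>+ x. ennreal (w u) * indicator {0..} u * ?L u x \<partial>lborel \<partial>lborel)"
    by (rule lborel_pair.Fubini') measurable
  also have "\<dots> = (\<integral>\<^sup>+ u. ennreal (w u) * indicator {0..} u * emeasure lborel {x. exp (- u) \<le> K x} \<partial>lborel)"
  proof (rule nn_integral_cong)
    fix u :: real
    have "?L u x = indicator {x. exp (- u) \<le> K x} x" for x
      by (auto simp: indicator_def)
    moreover have "{x. exp (- u) \<le> K x} \<in> sets lborel" by measurable
    ultimately show "(\<integral>\<^sup>+ x. ennreal (w u) * indicator {0..} u * ?L u x \<partial>lborel) =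
        ennreal (w u) * indicator {0..} u * emeasure lborel {x. exp (- u) \<le> K x}"
      by (simp add: nn_integral_cmult_indicator)
  qed
  finally show ?thesis .
qed

text \<open>
  One recursion serves both weights used later: \<open>w = exp (- u)\<close>, where the parameter is 0, and
  \<open>w = (1 - \<alpha> u) powr (1 / \<alpha> - 1)\<close>. The relation \<open>e = (1 - \<alpha> u) w\<close> turns integration by parts into
  \<open>J (k + 1) * (1 + (k + 1) \<alpha>) = (k + 1) * J k\<close> for the moments \<open>J k\<close>, which is where the factors
  \<open>1 + j \<alpha>\<close> of the final constant come from. The induction builds the antiderivatives that vanish at
  infinity, so that no integrability has to be discussed.
\<close>

lemma nn_integral_power_moment:
  fixes \<alpha> :: real and e w :: "real \<Rightarrow> real"
  assumes [measurable]: "w \<in> borel_measurable borel"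
    and deriv: "\<And>u. 0 \<le> u \<Longrightarrow> (e has_real_derivative - w u) (at u)"
    and e_eq: "\<And>u. 0 \<le> u \<Longrightarrow> e u = (1 - \<alpha> * u) * w u"
    and w: "\<And>u. 0 \<le> u \<Longrightarrow> 0 \<le> w u" and "e 0 = 1"
    and lim: "\<And>k. k \<le> n \<Longrightarrow> ((\<lambda>u. u ^ k * e u) \<longlongrightarrow> 0) at_top"
    and pos: "\<And>j. j \<le> n \<Longrightarrow> 0 < 1 + real j * \<alpha>"
  shows "(\<integral>\<^sup>+ u. ennreal (u ^ n * w u) * indicator {0..} u \<partial>lborel) =
    ennreal (fact n / (\<Prod>j = 1..n. (1 + real j * \<alpha>)))"
proof -
  have "\<exists>A. (\<forall>u\<ge>0. (A has_real_derivative u ^ k * w u) (at u)) \<and> (A \<longlongrightarrow> 0) at_top \<and>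
      A 0 = - (fact k / (\<Prod>j = 1..k. (1 + real j * \<alpha>)))" if "k \<le> n" for k
    using that
  proof (induction k)
    case 0
    have "((\<lambda>u. - e u) has_real_derivative w u) (at u)" if "0 \<le> u" for u
      using deriv[OF that] by (auto intro!: derivative_eq_intros)
    moreover have "((\<lambda>u. - e u) \<longlongrightarrow> 0) at_top"
      using tendsto_minus[OF lim[of 0]] by simp
    ultimately show ?case
      using \<open>e 0 = 1\<close> by (intro exI[of _ "\<lambda>u. - e u"]) simp
  next
    case (Suc k)
    then obtain A where A: "\<And>u. 0 \<le> u \<Longrightarrow> (A has_real_derivative u ^ k * w u) (at u)"
      "(A \<longlongrightarrow> 0) at_top" "A 0 = - (fact k / (\<Prod>j = 1..k. (1 + real j * \<alpha>)))"
      by auto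
    define q where "q = 1 + real (Suc k) * \<alpha>"
    have "q > 0" using pos[OF Suc.prems] by (simp add: q_def)
    let ?A = "\<lambda>u. (real (Suc k) * A u - u ^ Suc k * e u) / q"
    have "(?A has_real_derivative u ^ Suc k * w u) (at u)" if "0 \<le> u" for u
    proof -
      have "(?A has_real_derivative (real (Suc k) * (u ^ k * w u)
          - ((real (Suc k) * u ^ k) * e u + (- w u) * u ^ Suc k)) / q) (at u)"
        using DERIV_pow[of "Suc k" u]
        by (intro DERIV_cdivide DERIV_diff DERIV_cmult DERIV_mult A(1) deriv that) auto
      also have "(real (Suc k) * (u ^ k * w u)
          - ((real (Suc k) * u ^ k) * e u + (- w u) * u ^ Suc k)) / q = u ^ Suc k * w u"
        using \<open>q > 0\<close> by (simp add: e_eq[OF that] divide_simps) (simp add: q_def algebra_simps)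
      finally show ?thesis .
    qed
    moreover have "(?A \<longlongrightarrow> 0) at_top"
    proof -
      have "(?A \<longlongrightarrow> (real (Suc k) * 0 - 0) / q) at_top"
        using \<open>q > 0\<close> A(2) lim[OF Suc.prems] by (intro tendsto_intros) auto
      then show ?thesis by simp
    qed
    moreover have "?A 0 = - (fact (Suc k) / (\<Prod>j = 1..Suc k. (1 + real j * \<alpha>)))"
      using A(3) by (simp add: prod.nat_ivl_Suc' q_def)
    ultimately show ?case by blast
  qed
  then obtain A where A: "\<And>u. 0 \<le> u \<Longrightarrow> (A has_real_derivative u ^ n * w u) (at u)"
      "(A \<longlongrightarrow> 0) at_top" "A 0 = - (fact n / (\<Prod>j = 1..n. (1 + real j * \<alpha>)))"
    by blast
  have "(\<integral>\<^sup>+ u. ennreal (u ^ n * w u) * indicator {0..} u \<partial>lborel) = ennreal (0 - A 0)"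
    using A w by (intro nn_integral_FTC_atLeast) auto
  then show ?thesis using A(3) by simp
qed

text \<open>
  With \<open>p = - 1 / \<alpha>\<close> the function \<open>power_tail\<close> is \<open>(1 + u / p) powr (- p)\<close>, the counterpart for
  \<open>\<alpha> < 0\<close> of \<open>exp (- u)\<close>; \<open>power_density\<close> is minus its derivative.
\<close>

definition power_tail :: "real \<Rightarrow> real \<Rightarrow> real" where
  "power_tail \<alpha> u = (1 - \<alpha> * u) powr (1 / \<alpha>)"

definition power_density :: "real \<Rightarrow> real \<Rightarrow> real" where
  "power_density \<alpha> u = (1 - \<alpha> * u) powr (1 / \<alpha> - 1)"

lemma power_density_measurable [measurable]: "power_density \<alpha> \<in> borel_measurable borel"
  unfolding power_density_def by measurable

lemma power_tail_eq:
  assumes "\<alpha> < 0" "0 \<le> u"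
  shows "power_tail \<alpha> u = (1 - \<alpha> * u) * power_density \<alpha> u"
proof -
  have "0 < 1 - \<alpha> * u"
    using mult_nonpos_nonneg[of \<alpha> u] assms by simp
  then show ?thesis
    by (simp add: power_tail_def power_density_def powr_diff)
qed

lemma power_tail_deriv:
  assumes "\<alpha> < 0" "0 \<le> u"
  shows "(power_tail \<alpha> has_real_derivative - power_density \<alpha> u) (at u)"
proof -
  have "0 < 1 - \<alpha> * u"
    using mult_nonpos_nonneg[of \<alpha> u] assms by simp
  then show ?thesis
    unfolding power_tail_def power_density_def using assms(1)
    by (auto intro!: derivative_eq_intros simp: field_simps)
qed

lemma power_tail_moment_tendsto_0:
  assumes "\<alpha> < 0" "0 < 1 + real k * \<alpha>"
  shows "((\<lambda>u. u ^ k * power_tail \<alpha> u) \<longlongrightarrow> 0) at_top"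
proof -
  define a where "a = - \<alpha>"
  have a: "a > 0" "real k < 1 / a"
    using assms by (auto simp: a_def field_simps)
  define \<epsilon> where "\<epsilon> = 1 / a - real k"
  have "\<epsilon> > 0" using a by (simp add: \<epsilon>_def)
  \<comment> \<open>The exponent is split so that the sign of the resulting order of decay is visible.\<close>
  have "((\<lambda>u. u powr real k * (1 + a * u) powr (- (real k + \<epsilon>))) \<longlongrightarrow> 0) at_top"
    using \<open>\<epsilon> > 0\<close> \<open>a > 0\<close> by real_asymp
  moreover have "\<forall>\<^sub>F u in at_top. u powr real k * (1 + a * u) powr (- (real k + \<epsilon>)) = u ^ k * power_tail \<alpha> u"
    using eventually_gt_at_top[of 0]
    by eventually_elim (simp add: power_tail_def powr_realpow \<epsilon>_def a_def)
  ultimately show ?thesis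
    by (rule Lim_transform_eventually)
qed

text \<open>
  The ratio \<open>D\<close> of \<open>power_density\<close> to \<open>exp (- u)\<close> starts at 1, decreases on \<open>[0, 1]\<close> and then increases
  to infinity. It therefore crosses a level \<open>C \<ge> 1\<close> once, upwards.
\<close>

lemma single_crossing:
  assumes "\<alpha> < 0" "1 \<le> C"
  obtains t where "0 < t" and "\<And>u. 0 \<le> u \<Longrightarrow> u \<le> t \<Longrightarrow> power_density \<alpha> u \<le> C * exp (- u)"
    and "\<And>u. t \<le> u \<Longrightarrow> C * exp (- u) \<le> power_density \<alpha> u"
proof -
  define D where "D = (\<lambda>u. power_density \<alpha> u * exp u)"
  have D_iff: "power_density \<alpha> u = D u * exp (- u)" for u
    by (simp add: D_def exp_minus)
  have base: "0 < 1 - \<alpha> * u" if "0 \<le> u" for u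
    using mult_nonpos_nonneg[of \<alpha> u] assms that by simp
  have deriv: "(D has_real_derivative D u * (\<alpha> * (1 - u) / (1 - \<alpha> * u))) (at u)" if "0 \<le> u" for u
  proof -
    have "(D has_real_derivative (1 / \<alpha> - 1) * (1 - \<alpha> * u) powr (1 / \<alpha> - 1 - 1) * (- \<alpha>) * exp u
        + exp u * power_density \<alpha> u) (at u)"
      unfolding D_def power_density_def using base[OF that]
      by (auto intro!: derivative_eq_intros)
    also have "(1 / \<alpha> - 1) * (1 - \<alpha> * u) powr (1 / \<alpha> - 1 - 1) * (- \<alpha>) * exp u
        + exp u * power_density \<alpha> u = D u * (\<alpha> * (1 - u) / (1 - \<alpha> * u))"
    proof -
      have "(1 - \<alpha> * u) powr (1 / \<alpha> - 1 - 1) = power_density \<alpha> u / (1 - \<alpha> * u)"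
        using powr_diff[of "1 - \<alpha> * u" "1 / \<alpha> - 1" 1] base[OF that] by (simp add: power_density_def)
      then show ?thesis
        using base[OF that] assms(1)
        by (simp only: D_def) (simp add: divide_simps, simp add: algebra_simps)
    qed
    finally show ?thesis .
  qed
  have D_nonneg: "0 \<le> D u" for u
    by (simp add: D_def power_density_def)
  have dec: "D v \<le> D u" if "0 \<le> u" "u \<le> v" "v \<le> 1" for u v
  proof (rule DERIV_nonpos_imp_nonincreasing[OF that(2)])
    fix x assume x: "u \<le> x" "x \<le> v"
    have "D x * (\<alpha> * (1 - x) / (1 - \<alpha> * x)) \<le> 0"
      using x that D_nonneg base[of x] assms
      by (intro mult_nonneg_nonpos divide_nonpos_pos mult_nonpos_nonneg) auto
    then show "\<exists>y. (D has_real_derivative y) (at x) \<and> y \<le> 0"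
      using deriv[of x] x that by (meson order_trans)
  qed
  have inc: "D u \<le> D v" if "1 \<le> u" "u \<le> v" for u v
  proof (rule DERIV_nonneg_imp_nondecreasing[OF that(2)])
    fix x assume x: "u \<le> x" "x \<le> v"
    have "0 \<le> D x * (\<alpha> * (1 - x) / (1 - \<alpha> * x))"
      using x that D_nonneg base[of x] assms
      by (intro mult_nonneg_nonneg divide_nonneg_pos mult_nonpos_nonpos) auto
    then show "\<exists>y. (D has_real_derivative y) (at x) \<and> 0 \<le> y"
      using deriv[of x] x that by (meson order_trans zero_le_one)
  qed
  have "filterlim D at_top at_top"
    unfolding D_def power_density_def using assms(1) by real_asymp
  then have "\<forall>\<^sub>F b in at_top. C \<le> D b \<and> 1 \<le> b"
    by (auto simp: filterlim_at_top eventually_conj_iff eventually_ge_at_top)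
  then obtain b where b: "C \<le> D b" "1 \<le> b"
    by (auto simp: eventually_at_top_linorder)
  have "D 1 \<le> C"
    using dec[of 0 1] assms by (simp add: D_def power_density_def)
  moreover have "continuous_on {1..b} D"
    by (intro DERIV_continuous_on[OF has_field_derivative_at_within[OF deriv]]) auto
  ultimately obtain t where t: "1 \<le> t" "t \<le> b" "D t = C"
    using IVT'[of D 1 C b] b by auto
  show ?thesis
  proof (rule that[of t])
    fix u assume u: "0 \<le> u" "u \<le> t"
    have "D u \<le> C"
      using dec[of 0 u] inc[of u t] u t assms(2)
      by (cases "u \<le> 1") (auto simp: D_def power_density_def)
    then show "power_density \<alpha> u \<le> C * exp (- u)"
      unfolding D_iff by (intro mult_right_mono) auto
  next
    fix u assume "t \<le> u"
    then show "C * exp (- u) \<le> power_density \<alpha> u"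
      unfolding D_iff using inc[of t u] t by (intro mult_right_mono) auto
  qed (use t in auto)
qed


text \<open>
  If \<open>b - a\<close> changes sign once, from nonnegative to nonpositive, and has \<open>p\<close>-weighted integral 0,
  then multiplying the weight by a decreasing \<open>r\<close> can only favour \<open>b\<close>: everywhere
  \<open>(r u - r t) * (b u - a u) \<ge> 0\<close>. The proof uses this with all terms moved to the side where they
  are positive, so that no difference of possibly infinite quantities occurs.
\<close>

lemma integral_le_of_single_crossing:
  fixes a b p r V :: "real \<Rightarrow> ennreal"
  assumes [measurable]: "a \<in> borel_measurable lborel" "b \<in> borel_measurable lborel" "V \<in> borel_measurable lborel"
    "p \<in> borel_measurable lborel"
    and V: "\<And>u. 0 < u \<Longrightarrow> V u = p u * r u" and dec: "\<And>u v. 0 < u \<Longrightarrow> u \<le> v \<Longrightarrow> r v \<le> r u"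
    and t: "0 < t" "r t < \<infinity>"
    and less: "\<And>u. 0 < u \<Longrightarrow> u \<le> t \<Longrightarrow> a u \<le> b u" and greater: "\<And>u. t \<le> u \<Longrightarrow> b u \<le> a u"
    and ab_int: "(\<integral>\<^sup>+ u. a u * p u * indicator {0..} u \<partial>lborel) = (\<integral>\<^sup>+ u. b u * p u * indicator {0..} u \<partial>lborel)"
    and fin: "(\<integral>\<^sup>+ u. a u * p u * indicator {0..} u \<partial>lborel) < \<infinity>"
  shows "(\<integral>\<^sup>+ u. a u * indicator {0..} u * V u \<partial>lborel) \<le> (\<integral>\<^sup>+ u. b u * indicator {0..} u * V u \<partial>lborel)"
proof -
  define J where "J = (\<integral>\<^sup>+ u. a u * p u * indicator {0..} u \<partial>lborel)"
  have swap: "x * y + x' * y' \<le> x' * y + x * y'" if "x \<le> x'" "y' \<le> y" for x x' y y' :: ennreal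
  proof -
    obtain d where "x' = x + d" using \<open>x \<le> x'\<close> by (auto simp: le_iff_add)
    then show ?thesis
      using mult_left_mono[OF \<open>y' \<le> y\<close>, of d] by (auto simp: algebra_simps intro!: add_mono)
  qed
  have key: "a u * r u + b u * r t \<le> b u * r u + a u * r t" if "0 < u" for u
  proof (cases "u \<le> t")
    case True
    then show ?thesis using swap[OF less dec] that t by simp
  next
    case False
    then show ?thesis using swap[OF greater dec, of u t u] that t by (simp add: add.commute)
  qed
  have "(\<integral>\<^sup>+ u. a u * indicator {0..} u * V u \<partial>lborel) + J * r t
      = (\<integral>\<^sup>+ u. a u * indicator {0..} u * V u + b u * p u * indicator {0..} u * r t \<partial>lborel)"
    unfolding J_def ab_int by (simp add: nn_integral_add nn_integral_multc)
  also have "\<dots> \<le> (\<integral>\<^sup>+ u. b u * indicator {0..} u * V u + a u * p u * indicator {0..} u * r t \<partial>lborel)"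
  proof (rule nn_integral_mono_AE)
    show "AE u in lborel. a u * indicator {0..} u * V u + b u * p u * indicator {0..} u * r t
        \<le> b u * indicator {0..} u * V u + a u * p u * indicator {0..} u * r t"
      using AE_lborel_singleton[of "0::real"]
    proof eventually_elim
      fix u :: real assume "u \<noteq> 0"
      show "a u * indicator {0..} u * V u + b u * p u * indicator {0..} u * r t
        \<le> b u * indicator {0..} u * V u + a u * p u * indicator {0..} u * r t"
      proof (cases "0 < u")
        case True
        have "a u * V u + b u * p u * r t = p u * (a u * r u + b u * r t)"
          using V[OF True] by (simp add: algebra_simps)
        also have "\<dots> \<le> p u * (b u * r u + a u * r t)"
          by (intro mult_left_mono key True) auto
        also have "\<dots> = b u * V u + a u * p u * r t"
          using V[OF True] by (simp add: algebra_simps)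
        finally show ?thesis using True by simp
      qed (use \<open>u \<noteq> 0\<close> in simp)
    qed
  qed
  also have "\<dots> = (\<integral>\<^sup>+ u. b u * indicator {0..} u * V u \<partial>lborel) + J * r t"
    unfolding J_def by (simp add: nn_integral_add nn_integral_multc)
  finally have "J * r t + (\<integral>\<^sup>+ u. a u * indicator {0..} u * V u \<partial>lborel) \<le>
      J * r t + (\<integral>\<^sup>+ u. b u * indicator {0..} u * V u \<partial>lborel)"
    by (simp add: add.commute)
  moreover have "J * r t < \<infinity>"
    using fin t(2) by (simp add: J_def ennreal_mult_less_top)
  ultimately show ?thesis
    by (auto simp: ennreal_add_left_cancel_le)
qed

section \<open>From concavity with a negative parameter to log-concavity\<close>

text \<open>
  The substitution that turns \<open>\<alpha>\<close>-concavity into log-concavity, acting on values: for \<open>\<alpha> < 0\<close>, writing a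
  value in the form \<open>(1 + \<phi>) powr (1 / \<alpha>)\<close>, \<open>logify\<close> replaces it by \<open>exp (\<phi> / \<alpha>)\<close>, and \<open>unlogify\<close> is the
  inverse on \<open>[0, 1]\<close>. A function is \<open>\<alpha>\<close>-concave exactly when \<open>\<phi>\<close>, taken to be infinite where the
  function vanishes, is convex, and the \<open>\<alpha>\<close>-sum is infimal convolution of the functions \<open>\<phi>\<close>. The
  value 0 needs its own case, because \<open>0 powr \<alpha>\<close> and \<open>ln 0\<close> are 0.
\<close>

definition unlogify :: "real \<Rightarrow> real \<Rightarrow> real" where
  "unlogify \<alpha> d = (if \<alpha> = 0 then d else if d = 0 then 0 else power_tail \<alpha> (- ln d))"

definition logify :: "real \<Rightarrow> real \<Rightarrow> real" where
  "logify \<alpha> c = (if \<alpha> = 0 then c else if c = 0 then 0 else exp ((c powr \<alpha> - 1) / \<alpha>))"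

lemma unlogify_logify: "0 \<le> c \<Longrightarrow> unlogify \<alpha> (logify \<alpha> c) = c"
  by (simp add: unlogify_def logify_def power_tail_def powr_powr)

lemma power_tail_base_pos:
  assumes "\<alpha> \<le> 0" "0 < d" "d \<le> 1"
  shows "1 \<le> 1 + \<alpha> * ln (d :: real)"
  using mult_nonpos_nonpos[of \<alpha> "ln d"] assms by simp

lemma logify_unlogify:
  assumes "\<alpha> \<le> 0" "0 \<le> d" "d \<le> 1"
  shows "logify \<alpha> (unlogify \<alpha> d) = d"
  using power_tail_base_pos[of \<alpha> d] assms
  by (auto simp: unlogify_def logify_def power_tail_def powr_powr)

lemma logify_pos_iff [simp]: "\<alpha> \<noteq> 0 \<or> 0 \<le> c \<Longrightarrow> 0 < logify \<alpha> c \<longleftrightarrow> c \<noteq> 0"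
  by (auto simp: logify_def)

lemma logify_mono:
  assumes "\<alpha> \<le> 0" "0 \<le> a" "a \<le> b"
  shows "logify \<alpha> a \<le> logify \<alpha> b"
proof (cases "\<alpha> = 0 \<or> a = 0")
  case True
  then show ?thesis using assms by (auto simp: logify_def)
next
  case False
  then have "b powr \<alpha> \<le> a powr \<alpha>"
    using assms by (intro powr_mono2') auto
  then show ?thesis
    using False assms by (auto simp: logify_def intro: divide_right_mono_neg)
qed

lemma unlogify_mono:
  assumes "\<alpha> \<le> 0" "0 \<le> a" "a \<le> b" "b \<le> 1"
  shows "unlogify \<alpha> a \<le> unlogify \<alpha> b"
proof (cases "\<alpha> = 0 \<or> a = 0")
  case True
  then show ?thesis using assms by (auto simp: unlogify_def power_tail_def)
next
  case False
  have "1 + \<alpha> * ln b \<le> 1 + \<alpha> * ln a"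
    using False assms by (simp add: mult_left_mono_neg)
  then have "(1 + \<alpha> * ln a) powr (1 / \<alpha>) \<le> (1 + \<alpha> * ln b) powr (1 / \<alpha>)"
    using power_tail_base_pos[of \<alpha> b] False assms by (intro powr_mono2') auto
  then show ?thesis
    using False assms by (auto simp: unlogify_def power_tail_def)
qed

lemma logify_bounds:
  assumes "\<alpha> \<le> 0" "0 \<le> c" "c \<le> 1"
  shows "0 \<le> logify \<alpha> c" "logify \<alpha> c \<le> 1"
  using logify_mono[of \<alpha> c 1] assms by (auto simp: logify_def)

lemma alpha_term_eq_unlogify:
  shows "alpha_term \<alpha> a b = unlogify \<alpha> (logify \<alpha> a * logify \<alpha> b)"
proof (cases "\<alpha> = 0 \<or> a = 0 \<or> b = 0")
  case True
  then show ?thesis by (auto simp: alpha_term_def unlogify_def logify_def)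
next
  case False
  define s where "s = (a powr \<alpha> - 1) / \<alpha> + (b powr \<alpha> - 1) / \<alpha>"
  have "logify \<alpha> a * logify \<alpha> b = exp s"
    using False by (simp add: logify_def s_def exp_add)
  moreover have "\<alpha> * s = a powr \<alpha> + b powr \<alpha> - 2"
    using False by (simp add: s_def field_simps)
  ultimately show ?thesis
    using False by (simp add: alpha_term_def unlogify_def power_tail_def)
qed

lemma logify_alpha_mean:
  assumes "0 < a" "0 < b" "0 \<le> t" "t \<le> 1"
  shows "logify \<alpha> (alpha_mean \<alpha> t a b) = logify \<alpha> a powr t * logify \<alpha> b powr (1 - t)"
proof (cases "\<alpha> = 0")
  case False
  have pos: "0 < t * a powr \<alpha> + (1 - t) * b powr \<alpha>"
    using assms by (cases "t = 0") (auto intro: add_pos_nonneg)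
  have "(t * a powr \<alpha> + (1 - t) * b powr \<alpha> - 1) / \<alpha> =
      t * ((a powr \<alpha> - 1) / \<alpha>) + (1 - t) * ((b powr \<alpha> - 1) / \<alpha>)"
    using False by (simp add: field_simps)
  then show ?thesis
    using False assms pos
    by (simp add: logify_def alpha_mean_def powr_powr exp_powr_real exp_add mult.commute)
qed (simp add: logify_def alpha_mean_def)

text \<open>
  The \<open>\<alpha>\<close>-mean becomes the geometric mean and superlevels are only relabelled.
\<close>

lemma logify_in_C_alpha_0:
  fixes f :: "real ^ 'n \<Rightarrow> real"
  assumes f: "f \<in> C_alpha \<alpha>" and \<alpha>: "\<alpha> \<le> 0"
  shows "(\<lambda>x. logify \<alpha> (f x)) \<in> C_alpha 0"
proof -
  note f01 = C_alpha_bounds[OF f]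
  have conc: "alpha_concave \<alpha> f" and "f 0 = 1" and cpt: "\<And>c. c > 0 \<Longrightarrow> compact {x. c \<le> f x}"
    using f by (auto simp: C_alpha_iff_compact_superlevels)
  have "alpha_concave 0 (\<lambda>x. logify \<alpha> (f x))"
  proof (rule log_concaveI)
    fix x y and t :: real
    assume t: "0 \<le> t" "t \<le> 1" and "0 < logify \<alpha> (f x)" "0 < logify \<alpha> (f y)"
    then have pos: "0 < f x" "0 < f y"
      using f01(1)[of x] f01(1)[of y] by auto
    have "logify \<alpha> (f x) powr t * logify \<alpha> (f y) powr (1 - t) = logify \<alpha> (alpha_mean \<alpha> t (f x) (f y))"
      using logify_alpha_mean[OF pos t] by simp
    also have "\<dots> \<le> logify \<alpha> (f (t *\<^sub>R x + (1 - t) *\<^sub>R y))"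
      using conc pos t \<alpha> by (intro logify_mono) (auto simp: alpha_concave_def alpha_mean_def)
    finally show "logify \<alpha> (f x) powr t * logify \<alpha> (f y) powr (1 - t)
      \<le> logify \<alpha> (f (t *\<^sub>R x + (1 - t) *\<^sub>R y))" .
  qed (use logify_bounds \<alpha> f01 in auto)
  moreover have "compact {x. c \<le> logify \<alpha> (f x)}" if "c > 0" for c
  proof (cases "c \<le> 1")
    case True
    have "c \<le> logify \<alpha> (f x) \<longleftrightarrow> unlogify \<alpha> c \<le> f x" for x
    proof
      assume "c \<le> logify \<alpha> (f x)"
      then have "unlogify \<alpha> c \<le> unlogify \<alpha> (logify \<alpha> (f x))"
        using that f01 \<alpha> logify_bounds by (intro unlogify_mono) auto
      then show "unlogify \<alpha> c \<le> f x" using unlogify_logify f01 by simp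
    next
      assume "unlogify \<alpha> c \<le> f x"
      moreover have "0 \<le> unlogify \<alpha> c"
        using that by (simp add: unlogify_def power_tail_def)
      ultimately have "logify \<alpha> (unlogify \<alpha> c) \<le> logify \<alpha> (f x)"
        using \<alpha> by (intro logify_mono)
      then show "c \<le> logify \<alpha> (f x)"
        using logify_unlogify \<alpha> that True by simp
    qed
    moreover have "0 < unlogify \<alpha> c"
      using power_tail_base_pos[OF \<alpha> that True] that by (auto simp: unlogify_def power_tail_def)
    ultimately show ?thesis using cpt by simp
  next
    case False
    then have "{x. c \<le> logify \<alpha> (f x)} = {}"
      using logify_bounds(2)[OF \<alpha> f01] by (auto simp: not_le intro: le_less_trans)
    then show ?thesis by (simp only: compact_empty)
  qed
  moreover have "logify \<alpha> (f 0) = 1"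
    using \<open>f 0 = 1\<close> by (simp add: logify_def)
  ultimately show ?thesis
    using logify_bounds(2)[OF \<alpha> f01] by (simp add: C_alpha_iff_compact_superlevels)
qed

text \<open>
  An increasing change of values commutes with the supremum here because the supremum is attained
  on the log-concave side.
\<close>

lemma alpha_sum_eq_unlogify:
  fixes g h :: "real ^ 'n \<Rightarrow> real"
  assumes g: "g \<in> C_alpha \<alpha>" and h: "h \<in> C_alpha \<alpha>" and \<alpha>: "\<alpha> \<le> 0"
  shows "alpha_sum \<alpha> g h x =
    unlogify \<alpha> (alpha_sum 0 (\<lambda>y. logify \<alpha> (g y)) (\<lambda>z. logify \<alpha> (h z)) x)"
proof -
  let ?G = "\<lambda>y. logify \<alpha> (g y)" and ?H = "\<lambda>z. logify \<alpha> (h z)"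
  note GH = logify_in_C_alpha_0[OF g \<alpha>] logify_in_C_alpha_0[OF h \<alpha>]
  note g01 = C_alpha_bounds[OF g] and h01 = C_alpha_bounds[OF h]
  obtain y z where yz: "y + z = x" "\<And>y' z'. y' + z' = x \<Longrightarrow> ?G y' * ?H z' \<le> ?G y * ?H z"
    using log_sum_attained[OF GH] by blast
  have "alpha_sum \<alpha> g h x = unlogify \<alpha> (?G y * ?H z)"
    unfolding alpha_sum_def
  proof (rule cSup_eq_maximum)
    show "unlogify \<alpha> (?G y * ?H z) \<in> {alpha_term \<alpha> (g y) (h z) |y z. y + z = x}"
      using yz(1) alpha_term_eq_unlogify by force
  next
    fix v assume "v \<in> {alpha_term \<alpha> (g y) (h z) |y z. y + z = x}"
    then obtain y' z' where v: "y' + z' = x" "v = alpha_term \<alpha> (g y') (h z')" by blast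
    have "unlogify \<alpha> (?G y' * ?H z') \<le> unlogify \<alpha> (?G y * ?H z)"
      using logify_bounds[OF \<alpha> g01] logify_bounds[OF \<alpha> h01] yz(2)[OF v(1)] \<alpha>
      by (intro unlogify_mono) (auto simp: mult_le_one)
    then show "v \<le> unlogify \<alpha> (?G y * ?H z)"
      using alpha_term_eq_unlogify v(2) by simp
  qed
  then show ?thesis
    using log_sum_eqI[of y z x ?G ?H] yz by simp
qed

section \<open>Comparison of the integrals\<close>

text \<open>
  With \<open>p = - 1 / \<alpha>\<close> and \<open>d = exp (- u)\<close> this is \<open>exp (- u) \<le> (1 + u / p) powr (- p)\<close>, that is,
  \<open>ln (1 + u / p) \<le> u / p\<close>.
\<close>

lemma le_unlogify:
  assumes "\<alpha> \<le> 0" "0 \<le> d" "d \<le> 1"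
  shows "d \<le> unlogify \<alpha> d"
proof (cases "\<alpha> = 0 \<or> d = 0")
  case False
  have "ln (1 + \<alpha> * ln d) \<le> \<alpha> * ln d"
    using power_tail_base_pos[of \<alpha> d] assms False by (intro ln_add_one_self_le_self2) auto
  then have "ln d \<le> ln (1 + \<alpha> * ln d) / \<alpha>"
    using False assms(1) by (simp add: field_simps)
  then have "exp (ln d) \<le> exp (ln (1 + \<alpha> * ln d) / \<alpha>)" by (simp only: exp_le_cancel_iff)
  moreover have "exp (ln d) = d" using False assms by simp
  ultimately show ?thesis
    using power_tail_base_pos[of \<alpha> d] False assms
    by (simp add: unlogify_def power_tail_def powr_def)
qed (auto simp: unlogify_def)

lemma scaled_superlevel:
  fixes K :: "real ^ 'n \<Rightarrow> real"
  assumes [measurable]: "K \<in> borel_measurable borel" and "0 < u"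
  shows "emeasure lborel {x. c \<le> K x} = ennreal (u ^ CARD('n)) * emeasure lborel {x. c \<le> K (u *\<^sub>R x)}"
proof -
  have "(\<integral>\<^sup>+ x. indicator {x. c \<le> K x} x \<partial>lborel) =
      ennreal (u ^ CARD('n)) * (\<integral>\<^sup>+ x. indicator {x. c \<le> K x} (u *\<^sub>R x) \<partial>(lborel :: (real ^ 'n) measure))"
    using nn_integral_lborel_affine[of "indicator {x. c \<le> K x}" u 0] \<open>0 < u\<close> by simp
  also have "(\<lambda>x. indicator {x. c \<le> K x} (u *\<^sub>R x) :: ennreal) = indicator {x. c \<le> K (u *\<^sub>R x)}"
    by (auto simp: indicator_def)
  finally show ?thesis by simp
qed

lemma one_plus_mult_pos:
  fixes \<alpha> :: real
  assumes "0 < n" "j \<le> n" "- (1 / real n) < \<alpha>" "\<alpha> \<le> 0"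
  shows "0 < 1 + real j * \<alpha>"
proof -
  have "- 1 < real n * \<alpha>" using assms by (simp add: field_simps)
  also have "real n * \<alpha> \<le> real j * \<alpha>"
    using assms by (intro mult_right_mono_neg) auto
  finally show ?thesis by simp
qed

text \<open>
  A Berwald-type reverse of \<open>le_unlogify\<close> under the integral. Let \<open>V u\<close> be the volume of the
  superlevel of \<open>K\<close> at \<open>exp (- u)\<close>. Both integrals are integrals of \<open>V\<close> against a weight, by the layer
  cake formula. Log-concavity together with \<open>K 0 = 1\<close> makes the superlevels grow at most linearly:
  \<open>V u / u ^ n\<close> is decreasing. For \<open>V u = u ^ n\<close> the inequality is an equality, the constant being the
  ratio of two moments, and the crossing lemma shows that this is the extremal case.
\<close>

lemma unlogify_integral_le:
  fixes K :: "real ^ 'n \<Rightarrow> real"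
  assumes K: "K \<in> C_alpha 0" and \<alpha>: "- (1 / real CARD('n)) < \<alpha>" "\<alpha> \<le> 0"
  shows "L1_norm (\<lambda>x. unlogify \<alpha> (K x))
    \<le> ennreal (1 / (\<Prod>j = 1..CARD('n). (1 + real j * \<alpha>))) * L1_norm K"
proof (cases "\<alpha> = 0")
  case True
  then show ?thesis by (simp add: unlogify_def)
next
  case False
  then have neg: "\<alpha> < 0" using \<alpha>(2) by simp
  note [measurable] = borel_measurable_C_alpha[OF K]
  note K01 = C_alpha_bounds[OF K]
  let ?n = "CARD('n)"
  define C where "C = 1 / (\<Prod>j = 1..?n. (1 + real j * \<alpha>))"
  have pos: "0 < 1 + real j * \<alpha>" if "j \<le> ?n" for j
    using that \<alpha> by (intro one_plus_mult_pos[of ?n]) auto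
  have prod: "0 < (\<Prod>j = 1..?n. (1 + real j * \<alpha>))" "(\<Prod>j = 1..?n. (1 + real j * \<alpha>)) \<le> 1"
    using pos neg by (auto intro!: prod_pos prod_le_1 mult_nonneg_nonpos intro: less_imp_le)
  then have "1 \<le> C" by (simp add: C_def)
  define V where "V = (\<lambda>u. emeasure lborel {x. exp (- u) \<le> K x})"
  \<comment> \<open>This is \<open>V u / u ^ n\<close>, in a form whose monotonicity is an inclusion of sets.\<close>
  define r where "r = (\<lambda>u. emeasure lborel {x. exp (- u) \<le> K (u *\<^sub>R x)})"
  have "V = (\<lambda>u. \<integral>\<^sup>+ x. indicator {0..} (K x - exp (- u)) \<partial>lborel)"
  proof
    fix u
    have "V u = (\<integral>\<^sup>+ x. indicator {x. exp (- u) \<le> K x} x \<partial>lborel)"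
      by (simp add: V_def)
    also have "\<dots> = (\<integral>\<^sup>+ x. indicator {0..} (K x - exp (- u)) \<partial>lborel)"
      by (intro nn_integral_cong) (auto simp: indicator_def)
    finally show "V u = (\<integral>\<^sup>+ x. indicator {0..} (K x - exp (- u)) \<partial>lborel)" .
  qed
  then have V_meas [measurable]: "V \<in> borel_measurable borel" by simp
  have V_eq: "V u = ennreal (u ^ ?n) * r u" if "0 < u" for u
    unfolding V_def r_def using that by (intro scaled_superlevel) auto
  have r_dec: "r v \<le> r u" if "0 < u" "u \<le> v" for u v
    unfolding r_def
  proof (intro emeasure_mono subsetI CollectI)
    fix x assume "x \<in> {x. exp (- v) \<le> K (v *\<^sub>R x)}"
    then have "exp (- v) powr (u / v) \<le> K (v *\<^sub>R x) powr (u / v)"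
      using that by (intro powr_mono2) auto
    also have "\<dots> \<le> K ((u / v) *\<^sub>R (v *\<^sub>R x))"
      using log_concaveD[of K "u / v" "v *\<^sub>R x" 0] that K by (simp add: C_alpha_def)
    finally show "exp (- u) \<le> K (u *\<^sub>R x)"
      using that by (simp add: exp_powr_real)
  qed measurable
  have r_fin: "r t < \<infinity>" if "0 < t" for t
  proof -
    have "compact {x. exp (- t) \<le> K x}"
      using K by (simp add: C_alpha_iff_compact_superlevels)
    then have "V t < \<infinity>"
      unfolding V_def by (rule emeasure_compact_finite)
    then show ?thesis
      using V_eq[OF that] that by (auto simp: ennreal_mult_less_top)
  qed
  obtain t where t: "0 < t" "\<And>u. 0 \<le> u \<Longrightarrow> u \<le> t \<Longrightarrow> power_density \<alpha> u \<le> C * exp (- u)"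
    "\<And>u. t \<le> u \<Longrightarrow> C * exp (- u) \<le> power_density \<alpha> u"
    using single_crossing[OF neg \<open>1 \<le> C\<close>] by blast
  have tail_lim: "((\<lambda>u. u ^ k * power_tail \<alpha> u) \<longlongrightarrow> 0) at_top" if "k \<le> ?n" for k
    by (rule power_tail_moment_tendsto_0[OF neg pos[OF that]])
  have tail_deriv: "(power_tail \<alpha> has_real_derivative - power_density \<alpha> u) (at u)" if "0 \<le> u" for u
    by (rule power_tail_deriv[OF neg that])
  have exp_deriv: "((\<lambda>u. exp (- u)) has_real_derivative - exp (- u)) (at u)" for u :: real
    by (auto intro!: derivative_eq_intros)
  have exp_lim: "((\<lambda>u :: real. u ^ k * exp (- u)) \<longlongrightarrow> 0) at_top" for k
    using tendsto_power_div_exp_0[of k] by (simp add: exp_minus divide_inverse)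
  have power_moment: "(\<integral>\<^sup>+ u. ennreal (power_density \<alpha> u) * ennreal (u ^ ?n) * indicator {0..} u \<partial>lborel)
      = ennreal (C * fact ?n)"
  proof -
    have "(\<integral>\<^sup>+ u. ennreal (u ^ ?n * power_density \<alpha> u) * indicator {0..} u \<partial>lborel) =
      ennreal (fact ?n / (\<Prod>j = 1..?n. (1 + real j * \<alpha>)))"
      using tail_deriv power_tail_eq[OF neg] tail_lim pos
      by (intro nn_integral_power_moment[where e = "power_tail \<alpha>"])
        (auto simp: power_density_def power_tail_def[of _ 0])
    moreover have "ennreal (power_density \<alpha> u) * ennreal (u ^ ?n) * indicator {0..} u
        = ennreal (u ^ ?n * power_density \<alpha> u) * indicator {0..} u" for u
      by (auto simp: indicator_def ennreal_mult' power_density_def mult.commute)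
    ultimately show ?thesis by (simp add: C_def)
  qed
  have exp_moment: "(\<integral>\<^sup>+ u. ennreal (C * exp (- u)) * ennreal (u ^ ?n) * indicator {0..} u \<partial>lborel)
      = ennreal (C * fact ?n)"
  proof -
    have "(\<integral>\<^sup>+ u. ennreal (u ^ ?n * exp (- u)) * indicator {0..} u \<partial>lborel) =
      ennreal (fact ?n / (\<Prod>j = 1..?n. (1 + real j * 0)))"
      using exp_deriv exp_lim by (intro nn_integral_power_moment[where e = "\<lambda>u. exp (- u)"]) auto
    moreover have "ennreal (C * exp (- u)) * ennreal (u ^ ?n) * indicator {0..} u
        = ennreal C * (ennreal (u ^ ?n * exp (- u)) * indicator {0..} u)" for u :: real
      using \<open>1 \<le> C\<close> by (auto simp: indicator_def ennreal_mult' mult_ac)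
    ultimately show ?thesis
      using \<open>1 \<le> C\<close> by (simp add: nn_integral_cmult ennreal_mult')
  qed
  have "L1_norm (\<lambda>x. unlogify \<alpha> (K x)) =
      (\<integral>\<^sup>+ u. ennreal (power_density \<alpha> u) * indicator {0..} u * V u \<partial>lborel)"
    unfolding L1_norm_def V_def unlogify_def
    using nn_integral_layer_cake[of K "power_density \<alpha>" "power_tail \<alpha>"] K01 tail_deriv tail_lim[of 0] False
    by (simp add: power_density_def)
  also have "\<dots> \<le> (\<integral>\<^sup>+ u. ennreal (C * exp (- u)) * indicator {0..} u * V u \<partial>lborel)"
    using V_eq r_dec t r_fin[OF t(1)] exp_moment power_moment
    by (intro integral_le_of_single_crossing[where p = "\<lambda>u. ennreal (u ^ ?n)" and r = r and t = t])
      (auto intro: ennreal_leI)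
  also have "\<dots> = ennreal C * (\<integral>\<^sup>+ u. ennreal (exp (- u)) * indicator {0..} u * V u \<partial>lborel)"
    using \<open>1 \<le> C\<close> by (subst nn_integral_cmult[symmetric]) (simp_all add: ennreal_mult' mult_ac)
  also have "(\<integral>\<^sup>+ u. ennreal (exp (- u)) * indicator {0..} u * V u \<partial>lborel) = L1_norm K"
  proof -
    have "(\<integral>\<^sup>+ u. ennreal (exp (- u)) * indicator {0..} u * V u \<partial>lborel) =
        (\<integral>\<^sup>+ x. ennreal (if K x = 0 then 0 else exp (- (- ln (K x)))) \<partial>lborel)"
      unfolding V_def using K01 exp_deriv exp_lim[of 0]
      by (intro nn_integral_layer_cake[symmetric]) auto
    also have "\<dots> = L1_norm K"
      unfolding L1_norm_def using K01(1) by (intro nn_integral_cong) (auto simp: less_le)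
    finally show ?thesis .
  qed
  finally show ?thesis by (simp add: C_def)
qed

section \<open>The inequality\<close>

theorem corollary6p3:
  fixes \<alpha> :: real and f g h :: "real ^ 'n \<Rightarrow> real"
  assumes "\<alpha> \<in> {- (1 / real CARD('n)) <.. 0}"
    and "f \<in> C_alpha \<alpha>" and "g \<in> C_alpha \<alpha>" and "h \<in> C_alpha \<alpha>"
  shows "L1_norm f * L1_norm (alpha_sum \<alpha> g h)
    \<le> ennreal (4 ^ CARD('n) / (\<Prod>j = 1..CARD('n). (1 + real j * \<alpha>)\<^sup>2))
        * L1_norm (alpha_sum \<alpha> f g) * L1_norm (alpha_sum \<alpha> f h)"
proof -
  have \<alpha>: "- (1 / real CARD('n)) < \<alpha>" "\<alpha> \<le> 0"
    using assms(1) by auto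
  define F G H where "F = (\<lambda>x. logify \<alpha> (f x))" and "G = (\<lambda>x. logify \<alpha> (g x))"
    and "H = (\<lambda>x. logify \<alpha> (h x))"
  have C0: "F \<in> C_alpha 0" "G \<in> C_alpha 0" "H \<in> C_alpha 0"
    unfolding F_def G_def H_def using assms \<alpha> logify_in_C_alpha_0 by blast+
  define c where "c = 1 / (\<Prod>j = 1..CARD('n). (1 + real j * \<alpha>))"
  have f_eq: "f = (\<lambda>x. unlogify \<alpha> (F x))"
    using unlogify_logify C_alpha_bounds(1)[OF assms(2)] by (simp add: F_def)
  have sum_eq: "alpha_sum \<alpha> g h = (\<lambda>x. unlogify \<alpha> (alpha_sum 0 G H x))"
    "alpha_sum \<alpha> f g = (\<lambda>x. unlogify \<alpha> (alpha_sum 0 F G x))"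
    "alpha_sum \<alpha> f h = (\<lambda>x. unlogify \<alpha> (alpha_sum 0 F H x))"
    unfolding F_def G_def H_def using alpha_sum_eq_unlogify assms \<alpha> by blast+
  have increase: "L1_norm K \<le> L1_norm (\<lambda>x. unlogify \<alpha> (K x))" if "K \<in> C_alpha 0" for K :: "real ^ 'n \<Rightarrow> real"
    unfolding L1_norm_def using le_unlogify[OF \<alpha>(2)] C_alpha_bounds[OF that]
    by (intro nn_integral_mono ennreal_leI) simp
  have "L1_norm f * L1_norm (alpha_sum \<alpha> g h)
      \<le> (ennreal c * L1_norm F) * (ennreal c * L1_norm (alpha_sum 0 G H))"
    unfolding f_eq sum_eq c_def
    by (intro mult_mono unlogify_integral_le alpha_sum_0_in_C_alpha C0 \<alpha>) auto
  also have "\<dots> = ennreal c * ennreal c * (L1_norm F * L1_norm (alpha_sum 0 G H))"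
    by (simp add: mult_ac)
  also have "\<dots> \<le> ennreal c * ennreal c *
      (ennreal (4 ^ CARD('n)) * (L1_norm (alpha_sum 0 F G) * L1_norm (alpha_sum 0 F H)))"
    by (intro mult_left_mono log_concave_case C0) auto
  also have "\<dots> \<le> ennreal c * ennreal c *
      (ennreal (4 ^ CARD('n)) * (L1_norm (alpha_sum \<alpha> f g) * L1_norm (alpha_sum \<alpha> f h)))"
    unfolding sum_eq by (intro mult_left_mono mult_mono increase alpha_sum_0_in_C_alpha C0) auto
  also have "\<dots> = ennreal (4 ^ CARD('n) / (\<Prod>j = 1..CARD('n). (1 + real j * \<alpha>)\<^sup>2))
        * L1_norm (alpha_sum \<alpha> f g) * L1_norm (alpha_sum \<alpha> f h)"
  proof -
    have "0 \<le> c"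
      unfolding c_def
      by (intro divide_nonneg_nonneg prod_nonneg ballI less_imp_le[OF one_plus_mult_pos[of "CARD('n)"]] \<alpha>) auto
    moreover have "c * c * 4 ^ CARD('n) = 4 ^ CARD('n) / (\<Prod>j = 1..CARD('n). (1 + real j * \<alpha>)\<^sup>2)"
      by (simp add: c_def power2_eq_square prod.distrib)
    ultimately have "ennreal c * ennreal c * ennreal (4 ^ CARD('n)) =
        ennreal (4 ^ CARD('n) / (\<Prod>j = 1..CARD('n). (1 + real j * \<alpha>)\<^sup>2))"
      by (metis ennreal_mult' mult_nonneg_nonneg)
    then show ?thesis by (metis mult.assoc)
  qed
  finally show ?thesis .
qed

end
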